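(* Let $x$ be a complex number and $n$ a nonnegative integer such that all quantities below are defined. Then \[ \sum_{k=0}^n(-1)^k\binom{n}{k}\frac{\binom{2x+n+k}{k}}{\binom{x+k}{k}}kH_{k}=\frac{n(2x+n+1)}{x+1} \times\begin{cases} H_{m-1}(x+1)+2H_{2m}-H_m, & n=2m;\\[1mm] H_m-2H_{2m}-H_m(x+1)-\frac{x+1}{(2m+1)(x+m+1)}, & n=2m+1. \end{cases} \]
   Context: For a complex $y$ and an integer $k\ge 0$, $\binom{y}{k}=\frac{y(y-1)\cdots(y-k+1)}{k!}$. For complex $x$ and integer $n\ge0$, $H_0(x)=0$, $H_n(x)=\sum_{k=1}^n\frac{1}{x+k}$, and $H_n=H_n(0)$. For a negative index one uses the convention $H_{-j}(y)=-\sum_{i=0}^{j-1}\frac{1}{y-i}$ (e.g. $H_{-1}(y)=-1/y$); this only arises for $n=0$, where it is multiplied by $n=0$. *)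

theory Defs
  imports Complex_Main
begin

text \<open>
  \<open>gen_harm n x\<close> is $H_n(x)$ with an integer index: the second branch is the convention
  $H_{-j}(y) = -\sum_{i=0}^{j-1} 1/(y-i)$ for $j > 0$.
\<close>

definition gen_harm :: "int \<Rightarrow> complex \<Rightarrow> complex" where
  "gen_harm n x =
     (if n \<ge> 0 then \<Sum>k = 1..nat n. 1 / (x + of_nat k)
      else - (\<Sum>i<nat (- n). 1 / (x - of_nat i)))"

abbreviation harm_num :: "nat \<Rightarrow> complex" where
  "harm_num n \<equiv> gen_harm (int n) 0"

end

theory Submission
  imports Defs "HOL-Computational_Algebra.Formal_Power_Series"
begin

text \<open>
  With $w_{n,x}(k) = \frac{(-n)_k (2x+n+1)_k}{k!\,(x+1)_k}$, Chu--Vandermonde gives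
  $\sum_k w_{n,x}(k) \binom{k}{i} = (-1)^{n+i} w_{n,x}(i)$. Inserting
  $H_k = \sum_{i\ge1} (-1)^{i-1} \binom{k}{i} / i$ therefore removes the harmonic numbers and
  reduces the claim to $Q_{n-1}(x+1)$, where $Q_n(x) = \sum_{i=1}^n w_{n,x}(i)/i$. The difference
  $Q_n - Q_{n-1}$ is again a Chu--Vandermonde sum, equal to $-2/n$ for odd $n$ and to
  $-2/(n+2x)$ for even $n$.
\<close>

section \<open>Terminating hypergeometric terms and their Chu-Vandermonde sums\<close>

definition watson_term :: "nat \<Rightarrow> complex \<Rightarrow> nat \<Rightarrow> complex" where
  "watson_term n x k = pochhammer (- of_nat n) k * pochhammer (2 * x + of_nat n + 1) k
     / (fact k * pochhammer (x + 1) k)"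

text \<open>This is the integral of (P(t) - 1)/t over [0,1], where P(t) = sum_k w_k t^k has the
  terms \<open>watson_term n x k\<close> as coefficients.\<close>

definition watson_log_sum :: "nat \<Rightarrow> complex \<Rightarrow> complex" where
  "watson_log_sum n x = (\<Sum>i<n. watson_term n x (Suc i) / of_nat (Suc i))"

lemma watson_term_0 [simp]: "watson_term n x 0 = 1"
  by (simp add: watson_term_def)

lemma watson_term_eq_0: "n < k \<Longrightarrow> watson_term n x k = 0"
  by (simp add: watson_term_def pochhammer_of_nat_eq_0_lemma)

lemma sum_pochhammer_Vandermonde:
  fixes a c :: complex
  assumes "pochhammer c n \<noteq> 0"
  shows "(\<Sum>k\<le>n. pochhammer (- of_nat n) k * pochhammer a k / (fact k * pochhammer c k))
    = pochhammer (c - a) n / pochhammer c n"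
proof -
  have "\<forall>i\<in>{0..<n}. c \<noteq> - of_nat i"
    using assms by (auto simp: pochhammer_eq_0_iff)
  from Vandermonde_pochhammer[OF this, of a] show ?thesis
    by (simp add: atMost_atLeast0 mult.commute)
qed

text \<open>In Chu-Vandermonde the difference of the lower and the upper parameter is -(x + n), and
  (-(x + n))_n is (x + 1)_n read backwards, up to the sign (-1)^n.\<close>

lemma sum_watson_term:
  assumes "pochhammer (x + 1) n \<noteq> 0"
  shows "(\<Sum>k\<le>n. watson_term n x k) = (-1) ^ n"
proof -
  have *: "x + 1 - (2 * x + of_nat n + 1) = - (x + of_nat n)"
    by simp
  have "pochhammer (- (x + of_nat n)) n = (-1) ^ n * pochhammer (x + 1) n"
    by (subst pochhammer_minus) simp
  with sum_pochhammer_Vandermonde[OF assms, of "2 * x + of_nat n + 1"] assms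
  show ?thesis
    unfolding watson_term_def * by simp
qed

text \<open>The family is stable under shifting the start of the series: after splitting off the
  first i factors, 2x + n + 1 + i = 2(x + i) + (n - i) + 1, so the remaining factors have the same
  shape for n - i and x + i.\<close>

lemma watson_term_add:
  assumes "i \<le> n"
  shows "watson_term n x (i + l) * of_nat ((i + l) choose i)
    = watson_term n x i * watson_term (n - i) (x + of_nat i) l"
proof -
  have b: "of_nat ((i + l) choose i) = (fact (i + l) / (fact i * fact l) :: complex)"
    by (simp add: binomial_fact)
  have n: "- of_nat n + of_nat i = (- of_nat (n - i) :: complex)"
    using assms by (simp add: of_nat_diff)
  have a: "2 * x + of_nat n + 1 + of_nat i = 2 * (x + of_nat i) + of_nat (n - i) + 1"
    using assms by (simp add: of_nat_diff)
  have c: "x + 1 + of_nat i = x + of_nat i + 1"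
    by simp
  show ?thesis
    unfolding watson_term_def b pochhammer_product' n a c by (simp add: field_simps)
qed

text \<open>The reflection $P(1-t) = (-1)^n P(t)$ of $P(t) = \sum_k w_k t^k$, a Gegenbauer
  polynomial, read off from the Taylor coefficients at $t = 1$.\<close>

lemma sum_watson_term_binomial:
  assumes "pochhammer (x + 1) n \<noteq> 0"
  shows "(\<Sum>k\<le>n. watson_term n x k * of_nat (k choose i)) = (-1) ^ (n + i) * watson_term n x i"
proof (cases "i \<le> n")
  case True
  then obtain d where d: "n = i + d"
    using le_Suc_ex by blast
  have "(\<Sum>k\<le>n. watson_term n x k * of_nat (k choose i))
      = (\<Sum>k=i..n. watson_term n x k * of_nat (k choose i))"
    by (rule sum.mono_neutral_right) auto
  also have "\<dots> = (\<Sum>l\<le>d. watson_term n x (i + l) * of_nat ((i + l) choose i))"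
    unfolding d by (rule sum.reindex_bij_witness[of _ "\<lambda>l. i + l" "\<lambda>k. k - i"]) auto
  also have "\<dots> = watson_term n x i * (\<Sum>l\<le>d. watson_term d (x + of_nat i) l)"
    using True by (simp add: watson_term_add sum_distrib_left d)
  also have "(\<Sum>l\<le>d. watson_term d (x + of_nat i) l) = (-1) ^ d"
  proof (rule sum_watson_term)
    show "pochhammer (x + of_nat i + 1) d \<noteq> 0"
      using assms unfolding d pochhammer_product' by (auto simp: add_ac)
  qed
  also have "watson_term n x i * (-1) ^ d = (-1) ^ (n + i) * watson_term n x i"
    by (simp add: d power_add)
  finally show ?thesis .
next
  case False
  then have "(\<Sum>k\<le>n. watson_term n x k * of_nat (k choose i)) = 0"
    by (intro sum.neutral) auto
  with False show ?thesis
    by (simp add: watson_term_eq_0)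
qed

section \<open>Harmonic numbers as alternating binomial sums\<close>

lemma gen_harm_0 [simp]: "gen_harm 0 x = 0"
  by (simp add: gen_harm_def)

lemma gen_harm_Suc: "gen_harm (int (Suc n)) x = gen_harm (int n) x + 1 / (x + of_nat (Suc n))"
  by (simp add: gen_harm_def nat_add_distrib del: of_nat_Suc)

text \<open>By Pascal's rule the sum for k + 1 is the sum for k plus a remainder. Absorption turns
  that remainder into 1/(k + 1) times an alternating sum over row k + 1 without its initial entry,
  which is 1.\<close>

lemma harm_num_alternating:
  "harm_num k = (\<Sum>i<k. (-1) ^ i * of_nat (k choose Suc i) / of_nat (Suc i))"
proof (induction k)
  case 0
  show ?case by simp
next
  case (Suc k)
  have absorb: "of_nat (k choose i) / of_nat (Suc i)
      = (of_nat (Suc k choose Suc i) / of_nat (Suc k) :: complex)" for i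
  proof -
    have "of_nat (Suc i) * of_nat (Suc k choose Suc i) = (of_nat (Suc k) * of_nat (k choose i) :: complex)"
      using arg_cong[OF Suc_times_binomial_eq[of k i], of "of_nat :: nat \<Rightarrow> complex"]
      by (simp only: of_nat_mult mult.commute)
    then show ?thesis
      by (simp add: field_simps del: of_nat_Suc)
  qed
  have alt: "(\<Sum>i<Suc k. (-1) ^ i * of_nat (Suc k choose Suc i)) = (1 :: complex)"
  proof -
    have "(\<Sum>i\<le>Suc k. (-1) ^ i * of_nat (Suc k choose i)) = (0 :: complex)"
      by (rule choose_alternating_sum) simp
    then show ?thesis
      unfolding lessThan_Suc_atMost[symmetric] sum.lessThan_Suc_shift[of _ "Suc k"]
      by (simp add: sum_negf del: sum.lessThan_Suc binomial_Suc_Suc)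
  qed
  have "(\<Sum>i<Suc k. (-1) ^ i * of_nat (Suc k choose Suc i) / of_nat (Suc i))
      = (\<Sum>i<Suc k. (-1) ^ i * of_nat (k choose Suc i) / of_nat (Suc i))
        + (\<Sum>i<Suc k. (-1) ^ i * (of_nat (k choose i) / of_nat (Suc i) :: complex))"
    unfolding sum.distrib[symmetric]
    by (rule sum.cong) (auto simp: add_divide_distrib distrib_left)
  also have "(\<Sum>i<Suc k. (-1) ^ i * of_nat (k choose Suc i) / of_nat (Suc i)) = harm_num k"
    by (simp add: Suc.IH)
  also have "(\<Sum>i<Suc k. (-1) ^ i * (of_nat (k choose i) / of_nat (Suc i) :: complex))
      = (\<Sum>i<Suc k. (-1) ^ i * of_nat (Suc k choose Suc i)) / of_nat (Suc k)"
    unfolding absorb by (simp only: sum_divide_distrib times_divide_eq_right)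
  finally show ?case
    unfolding alt by (simp only: gen_harm_Suc add_0)
qed

section \<open>Elimination of the harmonic numbers\<close>

lemma watson_term_Suc_shift:
  "of_nat (Suc k) * watson_term (Suc n) x (Suc k)
    = - (of_nat (Suc n) * (2 * x + of_nat (Suc n) + 1) / (x + 1)) * watson_term n (x + 1) k"
proof -
  \<comment> \<open>As in differentiating a hypergeometric series, all three parameters rise by one.
    The raised parameters are those belonging to n and x + 1, which is where x + 1 in the final
    formula comes from.\<close>
  have "2 * x + of_nat (Suc n) + 1 + 1 = 2 * (x + 1) + of_nat n + 1"
    by simp
  then show ?thesis
    unfolding watson_term_def pochhammer_rec fact_Suc
    by (simp add: divide_simps del: of_nat_Suc) (simp add: algebra_simps)
qed

text \<open>The sign of the reflection formula cancels the sign of the harmonic expansion up to a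
  constant. What remains is a plain sum of the terms, with the initial 1 removed, and a sum with
  denominators that the shift moves to x + 1.\<close>

lemma sum_watson_term_harm_num:
  assumes "pochhammer (x + 1) (Suc n) \<noteq> 0"
  shows "(\<Sum>k\<le>Suc n. watson_term (Suc n) x k * of_nat k * harm_num k)
    = (-1) ^ n * ((-1) ^ Suc n - 1
        + of_nat (Suc n) * (2 * x + of_nat (Suc n) + 1) / (x + 1) * watson_log_sum n (x + 1))"
proof -
  let ?N = "Suc n" and ?w = "watson_term (Suc n) x"
  let ?c = "of_nat (Suc n) * (2 * x + of_nat (Suc n) + 1) / (x + 1)"
  \<comment> \<open>The bound is made independent of k, since the added binomials vanish; the two
    summations can then be interchanged.\<close>
  have harm: "harm_num k = (\<Sum>i<?N. (-1) ^ i * of_nat (k choose Suc i) / of_nat (Suc i))" if "k \<le> ?N" for k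
    unfolding harm_num_alternating by (rule sum.mono_neutral_left) (use that in auto)
  \<comment> \<open>The factor k is rewritten in the binomial basis, so that the reflection formula
    applies to each summand.\<close>
  have absorb: "of_nat k * of_nat (k choose Suc i) = (of_nat (Suc i) * of_nat (k choose Suc i)
      + of_nat (Suc (Suc i)) * of_nat (k choose Suc (Suc i)) :: complex)" for k i
  proof -
    have "k * (k choose Suc i) = Suc i * (k choose Suc i) + Suc (Suc i) * (k choose Suc (Suc i))"
    proof (cases "Suc i \<le> k")
      case True
      have "Suc (Suc i) * (k choose Suc (Suc i)) = (k - Suc i) * (k choose Suc i)"
        using True binomial_absorb_comp[of k "Suc i"] binomial_absorption[of "Suc i" k] by simp
      with True show ?thesis
        by (simp only: distrib_right[symmetric] le_add_diff_inverse)
    qed (simp add: binomial_eq_0)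
    then show ?thesis
      unfolding of_nat_mult[symmetric] of_nat_add[symmetric] by (rule arg_cong)
  qed
  have inner: "(\<Sum>k\<le>?N. ?w k * of_nat k * of_nat (k choose Suc i))
      = - ((-1) ^ (?N + i)) * (of_nat (Suc i) * ?w (Suc i) + ?c * watson_term n (x + 1) (Suc i))" for i
  proof -
    have "(\<Sum>k\<le>?N. ?w k * of_nat k * of_nat (k choose Suc i))
        = of_nat (Suc i) * (\<Sum>k\<le>?N. ?w k * of_nat (k choose Suc i))
          + of_nat (Suc (Suc i)) * (\<Sum>k\<le>?N. ?w k * of_nat (k choose Suc (Suc i)))"
      unfolding mult.assoc absorb sum_distrib_left sum.distrib[symmetric]
      by (rule sum.cong) (simp_all only: algebra_simps)
    also have "\<dots> = - ((-1) ^ (?N + i)) * (of_nat (Suc i) * ?w (Suc i) - of_nat (Suc (Suc i)) * ?w (Suc (Suc i)))"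
      unfolding sum_watson_term_binomial[OF assms] by (simp add: algebra_simps del: of_nat_Suc)
    finally show ?thesis
      unfolding watson_term_Suc_shift[of "Suc i"] by (simp only: minus_mult_left[symmetric] diff_minus_eq_add)
  qed
  have total: "(\<Sum>i<?N. ?w (Suc i)) = (-1) ^ ?N - 1"
    using sum_watson_term[OF assms]
    unfolding lessThan_Suc_atMost[symmetric] sum.lessThan_Suc_shift[of _ ?N]
    by (simp add: algebra_simps)
  have log: "(\<Sum>i<?N. watson_term n (x + 1) (Suc i) / of_nat (Suc i)) = watson_log_sum n (x + 1)"
    by (simp add: watson_log_sum_def watson_term_eq_0)
  have "(\<Sum>k\<le>?N. ?w k * of_nat k * harm_num k)
      = (\<Sum>k\<le>?N. \<Sum>i<?N. (-1) ^ i / of_nat (Suc i) * (?w k * of_nat k * of_nat (k choose Suc i)))"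
    by (rule sum.cong) (simp_all only: harm atMost_iff sum_distrib_left, simp add: mult_ac)
  also have "\<dots> = (\<Sum>i<?N. (-1) ^ i / of_nat (Suc i) * (\<Sum>k\<le>?N. ?w k * of_nat k * of_nat (k choose Suc i)))"
    by (subst sum.swap) (simp only: sum_distrib_left)
  also have "\<dots> = (\<Sum>i<?N. (-1) ^ n * (?w (Suc i) + ?c * (watson_term n (x + 1) (Suc i) / of_nat (Suc i))))"
  proof (rule sum.cong)
    fix i
    have sign: "(-1) ^ i * (- ((-1) ^ (?N + i))) = ((-1) ^ n :: complex)"
      by (simp add: power_add flip: mult.assoc)
    have "(-1) ^ i / s * (- ((-1) ^ (?N + i)) * (s * a + C * b))
        = (-1) ^ n * (a + C * (b / s))" if "s \<noteq> 0" for s a b C :: complex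
      using that unfolding sign[symmetric] by (simp add: field_simps)
    then show "(-1) ^ i / of_nat (Suc i) * (\<Sum>k\<le>?N. ?w k * of_nat k * of_nat (k choose Suc i))
        = (-1) ^ n * (?w (Suc i) + ?c * (watson_term n (x + 1) (Suc i) / of_nat (Suc i)))"
      unfolding inner by (simp only: of_nat_eq_0_iff nat.distinct not_False_eq_True)
  qed simp
  also have "\<dots> = (-1) ^ n * ((\<Sum>i<?N. ?w (Suc i))
      + ?c * (\<Sum>i<?N. watson_term n (x + 1) (Suc i) / of_nat (Suc i)))"
    by (simp only: sum_distrib_left[symmetric] sum.distrib)
  finally show ?thesis
    unfolding total log .
qed

section \<open>Recurrence and closed form for the sums with denominators\<close>

lemma watson_log_sum_Suc_diff:
  assumes "pochhammer (x + 1) (Suc n) \<noteq> 0"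
  shows "of_nat (Suc n) * (of_nat (Suc n) + 2 * x) * (watson_log_sum (Suc n) x - watson_log_sum n x)
    = 2 * ((-1) ^ Suc n * x - (of_nat (Suc n) + x))"
proof -
  let ?N = "Suc n"
  \<comment> \<open>One upper parameter is taken from each neighbour: -N from
    \<open>watson_term ?N x\<close>, and N + 2x = 2x + n + 1 from \<open>watson_term n x\<close>. By
    contiguity both terms are multiples of common factors, and their difference divided by the index
    is a multiple of \<open>v\<close>.\<close>
  define v where "v k = pochhammer (- of_nat ?N) k * pochhammer (of_nat ?N + 2 * x) k
      / (fact k * pochhammer (x + 1) k)" for k
  have Nx: "x + 1 + of_nat n \<noteq> 0"
    using assms by (simp add: pochhammer_Suc)
  \<comment> \<open>Chu-Vandermonde now gives (x)_N / (x + 1)_N up to sign, which telescopes to x/(x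
    + N).\<close>
  have sum_v: "(of_nat ?N + x) * (\<Sum>k\<le>?N. v k) = (-1) ^ ?N * x"
  proof -
    have "(\<Sum>k\<le>?N. v k) = pochhammer (x + 1 - (of_nat ?N + 2 * x)) ?N / pochhammer (x + 1) ?N"
      unfolding v_def by (rule sum_pochhammer_Vandermonde[OF assms])
    also have "x + 1 - (of_nat ?N + 2 * x) = - (x + of_nat n)"
      by simp
    also have "pochhammer (- (x + of_nat n)) ?N = (-1) ^ ?N * pochhammer x ?N"
      by (subst pochhammer_minus) simp
    also have "pochhammer x ?N = x * pochhammer (x + 1) n"
      by (rule pochhammer_rec)
    also have "(-1) ^ ?N * (x * pochhammer (x + 1) n) / pochhammer (x + 1) ?N = (-1) ^ ?N * x / (x + 1 + of_nat n)"
      using assms by (simp add: pochhammer_Suc)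
    finally show ?thesis
      using Nx by (simp add: add_ac)
  qed
  have summand: "of_nat ?N * (of_nat ?N + 2 * x) *
      (watson_term ?N x (Suc i) / of_nat (Suc i) - watson_term n x (Suc i) / of_nat (Suc i))
      = 2 * (of_nat ?N + x) * v (Suc i)" if "i < ?N" for i
  proof -
    define A where "A = pochhammer (- of_nat n :: complex) i"
    define B where "B = pochhammer (2 * x + of_nat ?N + 1) i"
    have 1: "pochhammer (- of_nat ?N) (Suc i) = - of_nat ?N * A"
      by (simp add: pochhammer_rec A_def)
    have 2: "pochhammer (2 * x + of_nat ?N + 1) (Suc i) = B * (2 * x + of_nat ?N + 1 + of_nat i)"
      by (simp add: pochhammer_Suc B_def)
    have 3: "pochhammer (- of_nat n) (Suc i) = A * (of_nat i - of_nat n)"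
      by (simp add: pochhammer_Suc A_def)
    have 4: "pochhammer (2 * x + of_nat n + 1) (Suc i) = (2 * x + of_nat ?N) * B"
      by (simp add: pochhammer_rec B_def algebra_simps)
    have 5: "pochhammer (of_nat ?N + 2 * x) (Suc i) = (2 * x + of_nat ?N) * B"
      by (simp add: pochhammer_rec B_def algebra_simps)
    have "watson_term ?N x (Suc i) - watson_term n x (Suc i)
        = - 2 * of_nat (Suc i) * (of_nat ?N + x) * A * B / (fact (Suc i) * pochhammer (x + 1) (Suc i))"
      unfolding watson_term_def 1 2 3 4 diff_divide_distrib[symmetric]
      by (rule arg_cong2[where f = "(/)"]) (simp_all add: algebra_simps)
    then have "(watson_term ?N x (Suc i) - watson_term n x (Suc i)) / of_nat (Suc i)
        = - (2 * (of_nat ?N + x) * A * B / (fact (Suc i) * pochhammer (x + 1) (Suc i)))"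
      by (simp add: mult_ac del: of_nat_Suc fact_Suc)
    then show ?thesis
      unfolding v_def 1 5 diff_divide_distrib[symmetric]
      by (simp del: of_nat_Suc fact_Suc)
  qed
  \<comment> \<open>Both sums get the same range, as the added term of index n + 1 is zero.\<close>
  have "watson_log_sum n x = (\<Sum>i<?N. watson_term n x (Suc i) / of_nat (Suc i))"
    by (simp add: watson_log_sum_def watson_term_eq_0)
  then have "of_nat ?N * (of_nat ?N + 2 * x) * (watson_log_sum ?N x - watson_log_sum n x)
      = (\<Sum>i<?N. 2 * (of_nat ?N + x) * v (Suc i))"
    unfolding watson_log_sum_def[of ?N] sum_subtractf[symmetric] sum_distrib_left
    by (simp only: sum_subtractf[symmetric] sum_distrib_left) (rule sum.cong, simp_all only: summand lessThan_iff)
  also have "\<dots> = 2 * (of_nat ?N + x) * ((\<Sum>k\<le>?N. v k) - 1)"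
    unfolding lessThan_Suc_atMost[symmetric] sum.lessThan_Suc_shift[of _ ?N]
    by (simp add: v_def[of 0] sum_distrib_left del: sum.lessThan_Suc)
  also have "\<dots> = 2 * ((of_nat ?N + x) * (\<Sum>k\<le>?N. v k) - (of_nat ?N + x))"
    by (simp only: right_diff_distrib mult.assoc mult_1_right)
  finally show ?thesis
    unfolding sum_v .
qed

text \<open>A nonzero (x + 1)_n makes all shorter denominators nonzero, so every summand is
  continuous at x.\<close>

lemma isCont_watson_log_sum:
  assumes "pochhammer (x + 1) n \<noteq> 0"
  shows "isCont (watson_log_sum n) x"
proof -
  have "pochhammer (x + 1) (Suc i) \<noteq> 0" if "i < n" for i
    using pochhammer_neq_0_mono[OF assms, of "Suc i"] that by simp
  then have "isCont (\<lambda>z. \<Sum>i<n. watson_term n z (Suc i) / of_nat (Suc i)) x"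
    unfolding watson_term_def
    by (intro continuous_intros isCont_o2[OF _ isCont_pochhammer])
       (auto simp del: of_nat_Suc fact_Suc)
  then show ?thesis
    unfolding watson_log_sum_def[abs_def] .
qed

text \<open>The recurrence degenerates at $2x = -(n+1)$, which is not a pole;
  there the value follows by continuity in $x$.\<close>

lemma watson_log_sum_Suc_odd:
  assumes "even n" "pochhammer (x + 1) (Suc n) \<noteq> 0"
  shows "watson_log_sum (Suc n) x = watson_log_sum n x - 2 / of_nat (Suc n)"
proof -
  have gen: "watson_log_sum (Suc n) z - watson_log_sum n z = - 2 / of_nat (Suc n)"
    if "pochhammer (z + 1) (Suc n) \<noteq> 0" "of_nat (Suc n) + 2 * z \<noteq> 0" for z
  proof -
    \<comment> \<open>For an odd new index the right side of the recurrence also carries the factor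
      n + 1 + 2z.\<close>
    have "of_nat (Suc n) * (of_nat (Suc n) + 2 * z) * (watson_log_sum (Suc n) z - watson_log_sum n z)
        = - 2 * (of_nat (Suc n) + 2 * z)"
      using watson_log_sum_Suc_diff[OF that(1)] assms(1) by (simp add: algebra_simps)
    then have "(of_nat (Suc n) + 2 * z) * (of_nat (Suc n) * (watson_log_sum (Suc n) z - watson_log_sum n z))
        = (of_nat (Suc n) + 2 * z) * (- 2)"
      by (simp only: mult_ac)
    then have "of_nat (Suc n) * (watson_log_sum (Suc n) z - watson_log_sum n z) = - 2"
      using that(2) by (simp only: mult_cancel_left) simp
    then show ?thesis
      using nonzero_mult_div_cancel_left[OF of_nat_neq_0[of n, where ?'a = complex],
          of "watson_log_sum (Suc n) z - watson_log_sum n z"] by simp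
  qed
  have "pochhammer (x + 1) n \<noteq> 0"
    using assms(2) by (simp add: pochhammer_Suc)
  then have "isCont (\<lambda>z. watson_log_sum (Suc n) z - watson_log_sum n z) x"
    using assms(2) by (intro continuous_intros isCont_watson_log_sum)
  then have lim: "((\<lambda>z. watson_log_sum (Suc n) z - watson_log_sum n z)
      \<longlongrightarrow> watson_log_sum (Suc n) x - watson_log_sum n x) (at x)"
    by (simp add: isCont_def)
  have "isCont (\<lambda>z. pochhammer (z + 1) (Suc n)) x"
    by (intro continuous_intros isCont_o2[OF _ isCont_pochhammer])
  then have "\<forall>\<^sub>F z in at x. pochhammer (z + 1) (Suc n) \<noteq> 0"
    using assms(2) unfolding isCont_def by (rule tendsto_imp_eventually_ne)
  moreover have "\<forall>\<^sub>F z in at x. z \<noteq> - of_nat (Suc n) / 2"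
    by (rule eventually_neq_at_within)
  ultimately have "\<forall>\<^sub>F z in at x. watson_log_sum (Suc n) z - watson_log_sum n z = - 2 / of_nat (Suc n)"
  proof eventually_elim
    case (elim z)
    then have "of_nat (Suc n) + 2 * z \<noteq> 0"
      by (auto simp: field_simps add_eq_0_iff simp del: of_nat_Suc)
    with elim(1) show ?case
      by (rule gen)
  qed
  then have "((\<lambda>z. watson_log_sum (Suc n) z - watson_log_sum n z) \<longlongrightarrow> - 2 / of_nat (Suc n)) (at x)"
    by (rule tendsto_eventually)
  from tendsto_unique[OF at_neq_bot lim this] show ?thesis
    by (simp add: algebra_simps)
qed

text \<open>Here the factor N + 2x equals 2(x + m + 1), which the hypothesis already keeps away from
  zero, so dividing is legitimate and no limit is taken.\<close>

lemma watson_log_sum_Suc_even: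
  assumes "pochhammer (x + 1) (2 * Suc m) \<noteq> 0"
  shows "watson_log_sum (2 * Suc m) x = watson_log_sum (Suc (2 * m)) x - 1 / (x + of_nat (Suc m))"
proof -
  have S: "2 * Suc m = Suc (Suc (2 * m))"
    by simp
  have ne: "x + of_nat (Suc m) \<noteq> 0"
    using assms unfolding pochhammer_eq_0_iff
    by (auto simp: add_eq_0_iff2 dest!: spec[of _ m])
  have two: "of_nat (2 * Suc m) + 2 * x = 2 * (x + of_nat (Suc m))"
    by (simp add: algebra_simps)
  have "of_nat (2 * Suc m) * (2 * (x + of_nat (Suc m)))
      * (watson_log_sum (2 * Suc m) x - watson_log_sum (Suc (2 * m)) x) = - 2 * of_nat (2 * Suc m)"
    using watson_log_sum_Suc_diff[of x "Suc (2 * m)"] assms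
    unfolding S[symmetric] two by (simp add: algebra_simps)
  then have "of_nat (2 * Suc m) * (2 * ((x + of_nat (Suc m))
      * (watson_log_sum (2 * Suc m) x - watson_log_sum (Suc (2 * m)) x)))
      = of_nat (2 * Suc m) * (2 * (- 1))"
    by (simp only: mult_ac) simp
  then have "(x + of_nat (Suc m)) * (watson_log_sum (2 * Suc m) x - watson_log_sum (Suc (2 * m)) x) = - 1"
    by (simp only: mult_cancel_left of_nat_eq_0_iff) simp
  with ne show ?thesis
    by (simp add: field_simps del: of_nat_Suc)
qed

text \<open>The summand 0 matches the shape that \<open>gen_harm_Suc\<close> yields at x =
  0.\<close>

lemma two_div_of_nat: "2 * (1 / (0 + of_nat (Suc (Suc (2 * m))))) = (1 / (0 + of_nat (Suc m)) :: complex)"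
proof -
  have "of_nat (Suc (Suc (2 * m))) = (2 * of_nat (Suc m) :: complex)"
    by simp
  then show ?thesis
    by (simp only: add_0) (simp del: of_nat_Suc)
qed

text \<open>Two recurrence steps at a time: the odd ones add up to -2 times the sum of odd
  reciprocals, which is H_m - 2 H_{2m}, and the even ones to -H_m(x).\<close>

lemma watson_log_sum_even:
  assumes "pochhammer (x + 1) (2 * m) \<noteq> 0"
  shows "watson_log_sum (2 * m) x = harm_num m - 2 * harm_num (2 * m) - gen_harm (int m) x"
  using assms
proof (induction m)
  case 0
  show ?case by (simp add: watson_log_sum_def gen_harm_def)
next
  case (Suc m)
  have S: "2 * Suc m = Suc (Suc (2 * m))"
    by simp
  have p: "pochhammer (x + 1) (2 * m) \<noteq> 0" "pochhammer (x + 1) (Suc (2 * m)) \<noteq> 0"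
    using pochhammer_neq_0_mono[OF Suc.prems] by simp_all
  have "watson_log_sum (2 * Suc m) x
      = harm_num m - 2 * harm_num (2 * m) - gen_harm (int m) x - 2 / of_nat (Suc (2 * m))
        - 1 / (x + of_nat (Suc m))"
    using watson_log_sum_Suc_even[OF Suc.prems] watson_log_sum_Suc_odd[OF _ p(2)] Suc.IH[OF p(1)]
    by simp
  then show ?case
    unfolding S gen_harm_Suc distrib_left two_div_of_nat by (simp add: algebra_simps)
qed

section \<open>Translation from generalized binomials, and the two parities\<close>

lemma gchoose_add_eq_pochhammer:
  fixes y :: complex
  shows "(y + of_nat k) gchoose k = pochhammer (y + 1) k / fact k"
  by (simp add: gbinomial_pochhammer')

lemma watson_term_eq_gchoose:
  "(-1) ^ k * of_nat (n choose k)
      * (((2 * x + of_nat n + of_nat k) gchoose k) / ((x + of_nat k) gchoose k))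
    = watson_term n x k"
proof -
  have "(-1) ^ k * of_nat (n choose k) = (pochhammer (- of_nat n) k / fact k :: complex)"
    by (simp add: binomial_gbinomial gbinomial_pochhammer flip: power_add mult.assoc)
  then show ?thesis
    by (simp add: gchoose_add_eq_pochhammer watson_term_def)
qed

theorem theorem2:
  fixes x :: complex and n :: nat
  assumes "\<And>k. k \<le> n \<Longrightarrow> (x + of_nat k) gchoose k \<noteq> 0"
    and "x + 1 \<noteq> 0"
  shows "(\<Sum>k = 0..n. (-1) ^ k * of_nat (n choose k)
            * (((2 * x + of_nat n + of_nat k) gchoose k) / ((x + of_nat k) gchoose k))
            * of_nat k * harm_num k)
       = of_nat n * (2 * x + of_nat n + 1) / (x + 1)
         * (let m = n div 2 in
            if even n
            then gen_harm (int m - 1) (x + 1) + 2 * harm_num (2 * m) - harm_num m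
            else harm_num m - 2 * harm_num (2 * m) - gen_harm (int m) (x + 1)
                 - (x + 1) / ((2 * of_nat m + 1) * (x + of_nat m + 1)))"
proof (cases n)
  \<comment> \<open>The factor n annihilates the right side, whatever the harmonic number of index
    -1 is.\<close>
  case 0
  then show ?thesis by simp
next
  case (Suc N)
  let ?c = "of_nat n * (2 * x + of_nat n + 1) / (x + 1)"
  have pn: "pochhammer (x + 1) n \<noteq> 0"
    using assms(1)[of n] by (simp add: gchoose_add_eq_pochhammer)
  then have pN: "pochhammer (x + 1 + 1) N \<noteq> 0"
    by (auto simp: Suc pochhammer_rec)
  have sum: "(\<Sum>k = 0..n. (-1) ^ k * of_nat (n choose k)
            * (((2 * x + of_nat n + of_nat k) gchoose k) / ((x + of_nat k) gchoose k))
            * of_nat k * harm_num k)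
      = (-1) ^ N * ((-1) ^ n - 1 + ?c * watson_log_sum N (x + 1))"
    unfolding watson_term_eq_gchoose using sum_watson_term_harm_num[OF pn[unfolded Suc]]
    unfolding Suc atMost_atLeast0 .
  show ?thesis
  proof (cases "even n")
    case True
    then have "odd N"
      by (simp add: Suc)
    \<comment> \<open>This \<open>m\<close> is one less than n div 2, so the index n div 2 - 1 of
      the claim is \<open>m\<close> itself and is not negative.\<close>
    then obtain m where "N = 2 * m + 1" ..
    then have m: "n = 2 * Suc m" "N = Suc (2 * m)"
      by (simp_all add: Suc)
    have "pochhammer (x + 1 + 1) (2 * m) \<noteq> 0"
      using pochhammer_neq_0_mono[OF pN] by (simp add: m)
    then have Q: "watson_log_sum N (x + 1) = harm_num m - 2 * harm_num (2 * m)
        - gen_harm (int m) (x + 1) - 2 / of_nat (Suc (2 * m))"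
      using watson_log_sum_Suc_odd[of "2 * m" "x + 1"] watson_log_sum_even[of "x + 1" m] pN
      by (simp add: m)
    have S: "2 * Suc m = Suc (Suc (2 * m))" "n div 2 = Suc m" "int (Suc m) - 1 = int m"
      by (simp_all add: m)
    have "gen_harm (int m) (x + 1) + 2 * harm_num (2 * Suc m) - harm_num (Suc m)
        = - watson_log_sum N (x + 1)"
      unfolding Q S(1) gen_harm_Suc distrib_left two_div_of_nat by (simp add: algebra_simps)
    moreover have "(-1) ^ N = (-1 :: complex)" "(-1) ^ n = (1 :: complex)"
      by (simp_all add: m)
    ultimately show ?thesis
      unfolding sum Let_def S(2,3) using True by simp
  next
    case False
    then obtain m where m: "n = Suc (2 * m)" "N = 2 * m"
      using Suc by (auto elim!: oddE)
    have ne: "x + of_nat m + 1 \<noteq> 0"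
      using pn unfolding pochhammer_eq_0_iff
      by (auto simp: m eq_neg_iff_add_eq_0 add_ac dest!: spec[of _ m])
    have ne': "2 * of_nat m + 1 \<noteq> (0 :: complex)"
      using of_nat_eq_0_iff[of "Suc (2 * m)", where ?'a = complex] by (simp add: algebra_simps)
    have n: "of_nat n = (2 * of_nat m + 1 :: complex)"
      by (simp add: m)
    \<comment> \<open>For odd n the reduction leaves the constant (-1)^n - 1 = -2; the extra
      fraction of the claim is that constant after division by the prefactor.\<close>
    have "?c * ((x + 1) / ((2 * of_nat m + 1) * (x + of_nat m + 1))) = 2"
      unfolding n using ne ne' assms(2) by (simp add: divide_simps)
    moreover have "(-1) ^ N = (1 :: complex)" "(-1) ^ n = (-1 :: complex)" "n div 2 = m"
      by (simp_all add: m)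
    moreover have "watson_log_sum N (x + 1) = harm_num m - 2 * harm_num (2 * m) - gen_harm (int m) (x + 1)"
      using watson_log_sum_even[of "x + 1" m] pN by (simp add: m)
    ultimately show ?thesis
      unfolding sum Let_def using False by (simp only: if_False right_diff_distrib) simp
  qed
qed

end
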